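(* Let $X\subseteq \mathbb{R}^d$ be closed and convex. Then the graph $G^1_{\mathbb{R}^d}[X]$ is connected if and only if $r(X)=0$, or $r(X)\geq 1$ and $X$ contains at least three affinely independent points. Moreover, if $X$ is bounded, then the graph diameter of $G^1_{\mathbb{R}^d}[X]$ is finite.
   Context: For $X\subseteq\mathbb{R}^d$, $G^1_{\mathbb{R}^d}[X]$ is the graph with vertex set $X$ in which $x,y\in X$ are joined by an edge exactly when their Euclidean distance is $1$. The graph distance between two vertices is the minimum number of edges in a path between them, and the graph diameter is the maximal graph distance between any pair of vertices. For a bounded set $X\subset\mathbb{R}^d$, the radius $r(X)$ is the radius of the minimal enclosing ball of $X$, i.e. the unique closed ball of minimal radius containing $X$. For unbounded $X$, $r(X)$ is regarded as infinite, so that $r(X)\geq 1$ holds.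
   Formalization: The final clause is stated for bounded X whose graph is connected; without connectedness it fails, e.g. for a segment of length 1/2, where distinct points are joined by no path and the graph diameter is not finite. *)

theory Defs
  imports "HOL-Analysis.Analysis" "Graph_Theory.Digraph_Component"
begin

text \<open>
  Simple graphs are represented, as in the session Graph_Theory, by symmetric loop-free digraphs:
  the edge joining x and y is the pair of arcs (x, y) and (y, x).
\<close>

definition unit_distance_graph :: "'a::metric_space set \<Rightarrow> ('a, 'a \<times> 'a) pre_digraph" where
  "unit_distance_graph X =
     with_proj \<lparr>pverts = X, parcs = {(x, y). x \<in> X \<and> y \<in> X \<and> dist x y = 1}\<rparr>"

text \<open>
  In contrast to the constant of the session Graph_Theory, the graph without vertices counts as
  connected here; see lemma \<open>graph_connected_iff\<close> below.
\<close>

definition graph_connected :: "('a, 'b) pre_digraph \<Rightarrow> bool" where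
  "graph_connected G \<longleftrightarrow> (\<forall>u\<in>verts G. \<forall>v\<in>verts G. \<exists>p. pre_digraph.apath G u p v)"

text \<open>An arc path is the list of its arcs, so its length is its number of edges.\<close>

definition graph_distance :: "('a, 'b) pre_digraph \<Rightarrow> 'a \<Rightarrow> 'a \<Rightarrow> enat" where
  "graph_distance G u v = (INF p\<in>{p. pre_digraph.apath G u p v}. enat (length p))"

definition graph_diameter :: "('a, 'b) pre_digraph \<Rightarrow> enat" where
  "graph_diameter G = (SUP u\<in>verts G. SUP v\<in>verts G. graph_distance G u v)"

definition minimal_enclosing_ball :: "'a::metric_space set \<Rightarrow> 'a \<Rightarrow> real \<Rightarrow> bool" where
  "minimal_enclosing_ball X c r \<longleftrightarrow>
     0 \<le> r \<and> X \<subseteq> cball c r \<and> (\<forall>c' r'. 0 \<le> r' \<and> X \<subseteq> cball c' r' \<longrightarrow> r \<le> r')"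

text \<open>
  For bounded subsets of a Euclidean space the description is proper, by
  \<open>minimal_enclosing_ball_exists\<close> and \<open>minimal_enclosing_ball_radius\<close> below.
  The empty set is enclosed by every ball of radius 0, hence gets radius 0.
\<close>

definition enclosing_radius :: "'a::metric_space set \<Rightarrow> ereal" where
  "enclosing_radius X =
     (if bounded X then ereal (THE r. \<exists>c. minimal_enclosing_ball X c r) else \<infinity>)"

lemma minimal_enclosing_ball_radius:
  assumes "minimal_enclosing_ball X c r"
  shows "enclosing_radius X = ereal r"
proof -
  have "(THE r. \<exists>c. minimal_enclosing_ball X c r) = r"
    using assms by (intro the_equality) (auto simp: minimal_enclosing_ball_def intro: antisym)
  moreover have "bounded X"
    using assms bounded_cball bounded_subset unfolding minimal_enclosing_ball_def by blast
  ultimately show ?thesis by (simp add: enclosing_radius_def)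
qed

lemma minimal_enclosing_ball_exists:
  fixes X :: "'a::euclidean_space set"
  assumes "bounded X"
  shows "\<exists>c r. minimal_enclosing_ball X c r"
proof (cases "X = {}")
  case True
  then have "minimal_enclosing_ball X 0 0" by (simp add: minimal_enclosing_ball_def)
  then show ?thesis by blast
next
  case False
  then obtain x where x: "x \<in> X" by blast
  define S where "S = {r. 0 \<le> r \<and> (\<exists>c. X \<subseteq> cball c r)}"
  define r where "r = Inf S"
  have ne: "S \<noteq> {}" using assms by (auto simp: S_def bounded_subset_cball)
  have bdd: "bdd_below S" by (auto simp: S_def bdd_below_def)
  have r0: "0 \<le> r" unfolding r_def using ne by (intro cInf_greatest) (auto simp: S_def)
  have "\<exists>c. X \<subseteq> cball c (r + inverse (real (Suc n)))" for n
  proof -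
    have "Inf S < r + inverse (real (Suc n))" unfolding r_def by simp
    then obtain s where "s \<in> S" "s < r + inverse (real (Suc n))"
      using cInf_less_iff[OF ne bdd] by blast
    then obtain c where "X \<subseteq> cball c s" "s \<le> r + inverse (real (Suc n))"
      unfolding S_def by auto
    then show ?thesis using subset_cball[of s _ c] by (meson order_trans)
  qed
  then obtain c where c: "\<And>n. X \<subseteq> cball (c n) (r + inverse (real (Suc n)))" by metis
  have "c n \<in> cball x (r + 1)" for n
  proof -
    have "inverse (real (Suc n)) \<le> 1" by (simp add: field_simps)
    moreover have "dist (c n) x \<le> r + inverse (real (Suc n))" using c[of n] x by auto
    ultimately show ?thesis by (simp add: dist_commute)
  qed
  then obtain l f where f: "strict_mono (f :: nat \<Rightarrow> nat)" "(c \<circ> f) \<longlonglongrightarrow> l"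
    using compact_cball[of x "r + 1"] unfolding compact_def by blast
  have "X \<subseteq> cball l r"
  proof
    fix y assume "y \<in> X"
    then have le: "dist ((c \<circ> f) n) y \<le> r + ((\<lambda>n. inverse (real (Suc n))) \<circ> f) n" for n
      using c[of "f n"] by auto
    have "((\<lambda>n. inverse (real (Suc n))) \<circ> f) \<longlonglongrightarrow> 0"
      using LIMSEQ_inverse_real_of_nat f(1) by (rule LIMSEQ_subseq_LIMSEQ)
    then have "(\<lambda>n. r + ((\<lambda>n. inverse (real (Suc n))) \<circ> f) n) \<longlonglongrightarrow> r + 0"
      by (intro tendsto_intros)
    moreover have "(\<lambda>n. dist ((c \<circ> f) n) y) \<longlonglongrightarrow> dist l y"
      using f(2) by (intro tendsto_intros)
    ultimately have "dist l y \<le> r + 0" using le by (intro LIMSEQ_le) auto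
    then show "y \<in> cball l r" by simp
  qed
  moreover have "r \<le> r'" if "0 \<le> r'" "X \<subseteq> cball c' r'" for c' r'
    unfolding r_def using that bdd by (intro cInf_lower) (auto simp: S_def)
  ultimately show ?thesis using r0 unfolding minimal_enclosing_ball_def by blast
qed

lemma unit_distance_graph_bidirected:
  "pair_bidirected_digraph \<lparr>pverts = X, parcs = {(x, y). x \<in> X \<and> y \<in> X \<and> dist x y = 1}\<rparr>"
  by unfold_locales (auto simp: symmetric_def sym_def dist_commute)

lemma graph_connected_iff:
  assumes "X \<noteq> {}"
  shows "graph_connected (unit_distance_graph X) \<longleftrightarrow>
    Digraph_Component.connected (unit_distance_graph X)"
proof -
  define P where "P = \<lparr>pverts = X, parcs = {(x, y). x \<in> X \<and> y \<in> X \<and> dist x y = 1}\<rparr>"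
  interpret pair_bidirected_digraph P
    unfolding P_def by (rule unit_distance_graph_bidirected)
  have "mk_symmetric (with_proj P) = P"
    by (auto simp: mk_symmetric_def P_def dist_commute)
  moreover have "(\<exists>p. apath u p v) \<longleftrightarrow> u \<rightarrow>\<^sup>*\<^bsub>with_proj P\<^esub> v" for u v
    using reachable_apath by blast
  moreover have "pverts P \<noteq> {}" using assms by (simp add: P_def)
  ultimately show ?thesis
    unfolding graph_connected_def Digraph_Component.connected_def strongly_connected_def
      unit_distance_graph_def P_def[symmetric] by simp
qed

end

theory Submission
  imports Defs
begin

text \<open>
  Let \<open>r(X) \<ge> 1\<close> and let \<open>X\<close> be at least two-dimensional.  Every point of \<open>X\<close> has a neighbour, and
  there is at most one point \<open>c\<close> such that the unit ball around \<open>c\<close> contains \<open>X\<close>.  A point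
  \<open>p \<noteq> c\<close> in the relative interior has a neighbour \<open>q\<close> in the relative interior, and alternating
  four unit steps close to \<open>q - p\<close> and \<open>p - q\<close> leads from \<open>p\<close> to all points near \<open>p\<close>.  Any other
  \<open>x \<noteq> c\<close> has such a neighbour \<open>p\<close>, and nearby points of \<open>x\<close> are reached by translating the edge from
  \<open>x\<close> to \<open>p\<close>.  Hence components are relatively open in the connected set \<open>X - {c}\<close>.  If \<open>X\<close> is
  bounded, the bound on the length of walks is uniform on the compact set \<open>X - ball c (1/2)\<close>, of which
  every point of \<open>X\<close> is at most one step away.
\<close>

section \<open>Walks of bounded length\<close>

definition unit_steps :: "'a::metric_space set \<Rightarrow> ('a \<times> 'a) set" where
  "unit_steps X = {(x, y). x \<in> X \<and> y \<in> X \<and> dist x y = 1}"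

text \<open>The reflexive closure allows idle steps, so \<open>n\<close> is only an upper bound for
  the number of edges. This makes the relation monotone in \<open>n\<close> and lets one bound serve
  many points. Idling is possible even outside \<open>X\<close>.\<close>

definition within_steps :: "'a::metric_space set \<Rightarrow> nat \<Rightarrow> 'a \<Rightarrow> 'a \<Rightarrow> bool" where
  "within_steps X n x y \<longleftrightarrow> (x, y) \<in> ((unit_steps X)\<^sup>=) ^^ n"

lemma within_steps_1:
  assumes "x \<in> X" "y \<in> X" "dist x y = 1"
  shows "within_steps X 1 x y"
  using assms by (simp add: within_steps_def unit_steps_def)

lemma within_steps_trans:
  assumes "within_steps X m x y" "within_steps X n y z"
  shows "within_steps X (m + n) x z"
  using assms by (auto simp: within_steps_def relpow_add)

lemma within_steps_refl: "within_steps X n x x"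
  by (induction n) (auto simp: within_steps_def)

lemma within_steps_mono:
  assumes "within_steps X m x y" "m \<le> n"
  shows "within_steps X n x y"
  using within_steps_trans[OF assms(1) within_steps_refl[of X "n - m" y]] assms(2) by simp

lemma within_steps_sym:
  assumes "within_steps X n x y"
  shows "within_steps X n y x"
proof -
  have "sym ((unit_steps X)\<^sup>=)" by (auto simp: sym_def unit_steps_def dist_commute)
  then have "sym (((unit_steps X)\<^sup>=) ^^ n)"
  proof (induction n)
    case (Suc n)
    then show ?case using relpow_commute[of "(unit_steps X)\<^sup>=" n]
      by (metis converse_relcomp relpow.simps(2) sym_conv_converse_eq)
  qed (simp add: sym_Id)
  then show ?thesis using assms by (auto simp: within_steps_def dest: symD)
qed

text \<open>Dropping idle steps gives an arc walk, and cutting out cycles makes it a path without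
  lengthening it. The empty walk must start at a vertex, hence \<open>x \<in> X\<close>.\<close>

lemma within_steps_arc_path:
  assumes "within_steps X n x y" "x \<in> X"
  shows "\<exists>p. pre_digraph.apath (unit_distance_graph X) x p y \<and> length p \<le> n"
proof -
  define P where "P = \<lparr>pverts = X, parcs = unit_steps X\<rparr>"
  interpret pair_bidirected_digraph P
    unfolding P_def unit_steps_def by (rule unit_distance_graph_bidirected)
  have G: "unit_distance_graph X = with_proj P"
    by (simp add: unit_distance_graph_def P_def unit_steps_def)
  have P: "pverts P = X" "parcs P = unit_steps X" by (simp_all add: P_def)
  have walk: "\<exists>p. awalk x p y \<and> length p \<le> n"
    using assms unfolding within_steps_def
  proof (induction n arbitrary: x)
    case 0
    then have "awalk x [] y" by (simp add: awalk_Nil_iff P)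
    then show ?case by auto
  next
    case (Suc n)
    then obtain z where z: "(x, z) \<in> (unit_steps X)\<^sup>=" "(z, y) \<in> ((unit_steps X)\<^sup>=) ^^ n"
      by (meson relpow_Suc_D2)
    then have "z \<in> X" using Suc.prems(2) by (auto simp: unit_steps_def)
    with Suc.IH z(2) obtain p where p: "awalk z p y" "length p \<le> n" by blast
    show ?case
    proof (cases "x = z")
      case True
      then show ?thesis using p by (intro exI[of _ p]) auto
    next
      case False
      then have "awalk x ((x, z) # p) y"
        using p(1) z(1) Suc.prems(2) by (simp add: awalk_Cons_iff P)
      then show ?thesis using p(2) by (intro exI[of _ "(x, z) # p"]) auto
    qed
  qed
  have "\<exists>q. apath x q y \<and> length q \<le> length p" if "awalk x p y" for p
    using that
  proof (induct rule: awalk_to_apath_induct)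
    case (path p)
    then show ?case by (auto simp: apath_def)
  next
    case (decomp p q r s)
    \<comment> \<open>Here \<open>r\<close> is the cycle that the induction removes, so the
      remaining walk \<open>q @ s\<close> is no longer than \<open>p\<close>.\<close>
    then have "p = q @ r @ s" by (auto elim: awalk_cyc_decompE)
    then show ?case using decomp by fastforce
  qed
  with walk show ?thesis unfolding G by (meson order_trans)
qed

lemma arc_path_within_steps:
  assumes "pre_digraph.apath (unit_distance_graph X) x p y"
  shows "within_steps X (length p) x y"
proof -
  define P where "P = \<lparr>pverts = X, parcs = unit_steps X\<rparr>"
  interpret pair_bidirected_digraph P
    unfolding P_def unit_steps_def by (rule unit_distance_graph_bidirected)
  have G: "unit_distance_graph X = with_proj P"
    by (simp add: unit_distance_graph_def P_def unit_steps_def)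
  have P: "pverts P = X" "parcs P = unit_steps X" by (simp_all add: P_def)
  have "awalk x p y" using assms unfolding G by (simp add: apath_def)
  then show ?thesis
  proof (induction p arbitrary: x)
    case Nil
    then show ?case by (simp add: awalk_Nil_iff within_steps_refl)
  next
    case (Cons e p)
    then have "e \<in> unit_steps X" "fst e = x" "awalk (snd e) p y"
      by (auto simp: awalk_Cons_iff P)
    then have "within_steps X 1 x (snd e)" "within_steps X (length p) (snd e) y"
      using Cons.IH by (auto simp: within_steps_def)
    then show ?case using within_steps_trans by fastforce
  qed
qed

lemma graph_connected_iff_within_steps:
  "graph_connected (unit_distance_graph X) \<longleftrightarrow> (\<forall>x\<in>X. \<forall>y\<in>X. \<exists>n. within_steps X n x y)"
proof -
  have "verts (unit_distance_graph X) = X" by (simp add: unit_distance_graph_def)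
  then show ?thesis unfolding graph_connected_def
    using within_steps_arc_path arc_path_within_steps by metis
qed

lemma finite_graph_diameter:
  assumes "\<And>x y. x \<in> X \<Longrightarrow> y \<in> X \<Longrightarrow> within_steps X n x y"
  shows "graph_diameter (unit_distance_graph X) < \<infinity>"
proof -
  have "graph_distance (unit_distance_graph X) x y \<le> enat n" if xy: "x \<in> X" "y \<in> X" for x y
  proof -
    obtain p where p: "pre_digraph.apath (unit_distance_graph X) x p y" "length p \<le> n"
      using within_steps_arc_path[OF assms[OF xy] xy(1)] by blast
    have "graph_distance (unit_distance_graph X) x y \<le> enat (length p)"
      unfolding graph_distance_def using p(1) by (intro INF_lower) simp
    then show ?thesis using p(2) by (meson enat_ord_simps(1) order_trans)
  qed
  moreover have "verts (unit_distance_graph X) = X" by (simp add: unit_distance_graph_def)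
  ultimately have "graph_diameter (unit_distance_graph X) \<le> enat n"
    unfolding graph_diameter_def by (intro SUP_least) simp
  then show ?thesis using enat_ord_simps(4) order_le_less_trans by blast
qed

section \<open>Sums of two unit vectors\<close>

lemma subspace_orthogonal_vector:
  fixes V :: "'a::euclidean_space set"
  assumes "subspace V" "2 \<le> dim V" "0 \<le> t" and "m \<in> V"
  shows "\<exists>h\<in>V. h \<bullet> m = 0 \<and> norm h = t"
proof -
  have "span {m} \<subseteq> span V" using assms(4) by (intro span_mono) auto
  moreover have "dim {m} \<le> 1" using dim_le_card[of "{m}" "{m}"] by (simp add: span_base)
  then have "span {m} \<noteq> span V" using assms(2) by (metis dim_span numeral_le_one_iff order_trans semiring_norm(69))
  ultimately obtain x where x: "x \<noteq> 0" "x \<in> span V" "\<And>y. y \<in> span {m} \<Longrightarrow> orthogonal x y"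
    using orthogonal_to_subspace_exists_gen by blast
  then have "x \<in> V" "x \<bullet> m = 0"
    using assms(1) span_eq_iff[of V] by (metis, auto simp: orthogonal_def span_base)
  then show ?thesis using x(1) assms
    by (intro bexI[of _ "(t / norm x) *\<^sub>R x"]) (auto simp: subspace_scale)
qed

text \<open>Take \<open>a\<close>, \<open>b\<close> as \<open>m / 2\<close> plus and minus a vector
  \<open>h\<close> orthogonal to \<open>m\<close>, with the length of \<open>h\<close> fixed by
  Pythagoras; dimension 2 leaves room for \<open>h\<close>. The ball of admissible \<open>m\<close>
  is centred at \<open>(2 - \<eta>) *\<^sub>R u\<close> rather than at \<open>2 *\<^sub>R u\<close>
  so that all its points have norm below 2, which makes \<open>h\<close> nonzero.\<close>

lemma sum_of_two_unit_vectors: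
  fixes V :: "'a::euclidean_space set"
  assumes V: "subspace V" "2 \<le> dim V" and u: "u \<in> V" "norm u = 1" and "0 < e"
  obtains \<eta> where "0 < \<eta>" and "\<And>m. m \<in> V \<Longrightarrow> norm (m - (2 - \<eta>) *\<^sub>R u) \<le> \<eta> / 2 \<Longrightarrow>
    \<exists>a\<in>V. \<exists>b\<in>V. norm a = 1 \<and> norm b = 1 \<and> norm (a - u) < e \<and> norm (b - u) < e \<and> a \<noteq> b \<and> a + b = m"
proof -
  \<comment> \<open>The squared norm of \<open>h\<close> is of first order in \<open>\<eta>\<close>,
    so \<open>\<eta>\<close> has to be quadratic in the tolerance. Capping the tolerance at 1 gives
    \<open>d\<^sup>2 \<le> d\<close>, which also makes the terms linear in \<open>\<eta>\<close>
    small.\<close>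
  define d where "d = min e 1"
  define \<eta> where "\<eta> = d\<^sup>2 / 8"
  have d: "0 < d" "d \<le> e" "d \<le> 1" using \<open>0 < e\<close> by (auto simp: d_def)
  have "d\<^sup>2 \<le> d" using d by (simp add: power2_eq_square mult_left_le)
  then have \<eta>: "0 < \<eta>" "\<eta> \<le> 1 / 8" "\<eta> \<le> d / 8" using d by (auto simp: \<eta>_def)
  show thesis
  proof (rule that[OF \<eta>(1)])
    fix m assume m: "m \<in> V" "norm (m - (2 - \<eta>) *\<^sub>R u) \<le> \<eta> / 2"
    have nu: "norm ((2 - \<eta>) *\<^sub>R u) = 2 - \<eta>" using u \<eta> by simp
    have m_ub: "norm m \<le> 2 - \<eta> / 2"
      using norm_triangle_sub[of m "(2 - \<eta>) *\<^sub>R u"] m(2) nu by simp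
    have m_lb: "2 - 3 / 2 * \<eta> \<le> norm m"
      using norm_triangle_ineq2[of "(2 - \<eta>) *\<^sub>R u" m] m(2) nu by (simp add: norm_minus_commute)
    have lt1: "(norm m / 2)\<^sup>2 < 1" using m_ub \<eta> by (simp add: abs_square_less_1)
    then obtain h where h: "h \<in> V" "h \<bullet> m = 0" "norm h = sqrt (1 - (norm m / 2)\<^sup>2)"
      using subspace_orthogonal_vector[OF V _ m(1)] by (metis diff_ge_0_iff_ge less_imp_le real_sqrt_ge_0_iff)
    then have h2: "(norm h)\<^sup>2 = 1 - (norm m / 2)\<^sup>2" using lt1 by simp
    have "(norm h)\<^sup>2 \<le> (d / 2)\<^sup>2"
    proof -
      have "(1 - 3 / 4 * \<eta>)\<^sup>2 \<le> (norm m / 2)\<^sup>2" using m_lb \<eta> by (intro power_mono) auto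
      then have "(norm h)\<^sup>2 \<le> 3 / 2 * \<eta> - 9 / 16 * \<eta>\<^sup>2"
        unfolding h2 by (simp add: power2_eq_square algebra_simps)
      also have "\<dots> \<le> 3 / 2 * \<eta>" by simp
      also have "\<dots> \<le> (d / 2)\<^sup>2" by (simp add: \<eta>_def power_divide)
      finally show ?thesis .
    qed
    then have hd: "norm h \<le> d / 2" using d by (simp add: power2_le_iff_abs_le)
    have "norm (m - (2 - \<eta>) *\<^sub>R u - \<eta> *\<^sub>R u) \<le> \<eta> / 2 + \<eta>"
      using norm_triangle_ineq4[of "m - (2 - \<eta>) *\<^sub>R u" "\<eta> *\<^sub>R u"] m(2) u \<eta>(1) by simp
    moreover have "m - (2 - \<eta>) *\<^sub>R u - \<eta> *\<^sub>R u = 2 *\<^sub>R ((1 / 2) *\<^sub>R m - u)"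
      by (simp add: algebra_simps scaleR_2)
    ultimately have mu: "norm ((1 / 2) *\<^sub>R m - u) \<le> 3 / 4 * \<eta>" by simp
    define a where "a = (1 / 2) *\<^sub>R m + h"
    define b where "b = (1 / 2) *\<^sub>R m - h"
    have unit: "norm a = 1" "norm b = 1"
    proof -
      have "(norm a)\<^sup>2 = (norm m / 2)\<^sup>2 + (norm h)\<^sup>2" "(norm b)\<^sup>2 = (norm m / 2)\<^sup>2 + (norm h)\<^sup>2"
        using h(2) by (simp_all add: a_def b_def power2_norm_eq_inner inner_simps inner_commute power_divide)
      then have "(norm a)\<^sup>2 = 1" "(norm b)\<^sup>2 = 1" using h2 by auto
      then show "norm a = 1" "norm b = 1" by (simp_all add: power2_eq_1_iff)
        (metis norm_ge_zero not_one_le_zero neg_0_le_iff_le)+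
    qed
    have "a \<in> V" "b \<in> V" using V(1) m(1) h(1)
      by (simp_all add: a_def b_def subspace_add subspace_diff subspace_scale)
    moreover have "norm (a - u) < e" "norm (b - u) < e"
    proof -
      have *: "3 / 4 * \<eta> + d / 2 < e" using \<eta> d by simp
      show "norm (a - u) < e"
        using norm_triangle_ineq[of "(1 / 2) *\<^sub>R m - u" h] mu hd * by (simp add: a_def algebra_simps)
      show "norm (b - u) < e"
        using norm_triangle_ineq4[of "(1 / 2) *\<^sub>R m - u" h] mu hd * by (simp add: b_def algebra_simps)
    qed
    moreover have "a \<noteq> b"
    proof
      assume "a = b"
      then have "h = 0" by (simp add: a_def b_def eq_neg_iff_add_eq_0 flip: scaleR_2)
      then show False using h2 lt1 by simp
    qed
    moreover have "a + b = m" by (simp add: a_def b_def flip: scaleR_2)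
    ultimately show "\<exists>a\<in>V. \<exists>b\<in>V. norm a = 1 \<and> norm b = 1 \<and> norm (a - u) < e \<and> norm (b - u) < e
        \<and> a \<noteq> b \<and> a + b = m" using unit by blast
  qed
qed

section \<open>Moving a point locally\<close>

lemma affine_hull_directions:
  fixes X :: "'a::euclidean_space set"
  assumes "2 \<le> aff_dim X" "a \<in> affine hull X"
  shows "subspace ((\<lambda>x. x - a) ` (affine hull X))" "2 \<le> dim ((\<lambda>x. x - a) ` (affine hull X))"
proof -
  show "subspace ((\<lambda>x. x - a) ` (affine hull X))"
    using assms by (intro affine_diffs_subspace_subtract) (auto simp: affine_affine_hull)
  have "aff_dim (affine hull X) = int (dim ((\<lambda>x. x - a) ` (affine hull X)))"
    using assms(2) by (intro aff_dim_eq_dim_subtract) (simp add: hull_hull)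
  then show "2 \<le> dim ((\<lambda>x. x - a) ` (affine hull X))" using assms(1) by simp
qed

lemma rel_interior_ball:
  assumes "p \<in> rel_interior X"
  shows "\<exists>e>0. ball p e \<inter> affine hull X \<subseteq> rel_interior X"
  using assms openin_rel_interior[of X] by (simp add: openin_contains_ball)

text \<open>
  A small displacement \<open>w\<close> of \<open>p\<close> is written as \<open>m - m'\<close> with \<open>m\<close>, \<open>m'\<close> close to \<open>2 (q - p)\<close> and of
  norm less than 2, and then \<open>m\<close> and \<open>m'\<close> are sums of two unit vectors close to \<open>q - p\<close>.  Taking the
  four unit steps with alternating signs keeps the walk close to \<open>p\<close> and \<open>q\<close>.
\<close>

lemma rel_interior_local_walk:
  fixes X :: "'a::euclidean_space set"
  assumes dim: "2 \<le> aff_dim X" and p: "p \<in> rel_interior X" and q: "q \<in> rel_interior X"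
    and pq: "dist p q = 1"
  obtains \<delta> where "0 < \<delta>" "\<And>p'. p' \<in> X \<Longrightarrow> dist p p' < \<delta> \<Longrightarrow> within_steps X 4 p p'"
proof -
  define A where "A = affine hull X"
  define V where "V = (\<lambda>x. x - p) ` A"
  have XA: "X \<subseteq> A" by (simp add: A_def hull_subset)
  have pX: "p \<in> X" and qX: "q \<in> X" using p q rel_interior_subset by auto
  have V: "subspace V" "2 \<le> dim V"
    unfolding V_def A_def using affine_hull_directions[OF dim, of p] pX by (auto simp: hull_inc)
  have inA: "p + v \<in> A \<longleftrightarrow> v \<in> V" for v unfolding V_def by force
  define u where "u = q - p"
  have u: "u \<in> V" "norm u = 1"
    using qX XA pq by (auto simp: u_def V_def dist_norm norm_minus_commute)
  obtain e1 where e1: "0 < e1" "ball p e1 \<inter> A \<subseteq> X"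
    using rel_interior_ball[OF p] rel_interior_subset[of X] unfolding A_def by (meson order_trans)
  obtain e2 where e2: "0 < e2" "ball q e2 \<inter> A \<subseteq> X"
    using rel_interior_ball[OF q] rel_interior_subset[of X] unfolding A_def by (meson order_trans)
  \<comment> \<open>The intermediate points \<open>p + a\<close>, \<open>p + (a - c)\<close>,
    \<open>p + (a - c + b)\<close> accumulate errors below \<open>e\<close>, \<open>2 * e\<close>,
    \<open>3 * e\<close>, relative to \<open>q\<close>, \<open>p\<close>, \<open>q\<close> in
    turn.\<close>
  define e where "e = min e1 e2 / 3"
  have e: "0 < e" "3 * e \<le> e1" "3 * e \<le> e2" using e1 e2 by (auto simp: e_def)
  have near_p: "p + v \<in> X" if "v \<in> V" "norm v < 3 * e" for v
    using that e e1 inA by (auto simp: dist_norm)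
  have near_q: "p + v \<in> X" if "v \<in> V" "norm (v - u) < 3 * e" for v
  proof -
    have "dist q (p + v) < e2"
      using that e by (simp add: dist_norm u_def norm_minus_commute[of q] algebra_simps)
    then show ?thesis using that e2 inA by auto
  qed
  obtain \<eta> where \<eta>: "0 < \<eta>" "\<And>m. m \<in> V \<Longrightarrow> norm (m - (2 - \<eta>) *\<^sub>R u) \<le> \<eta> / 2 \<Longrightarrow>
    \<exists>a\<in>V. \<exists>b\<in>V. norm a = 1 \<and> norm b = 1 \<and> norm (a - u) < e \<and> norm (b - u) < e \<and> a \<noteq> b \<and> a + b = m"
    using sum_of_two_unit_vectors[OF V u e(1)] by blast
  show thesis
  proof (rule that[OF \<eta>(1)])
    fix p' assume p': "p' \<in> X" "dist p p' < \<eta>"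
    \<comment> \<open>Splitting \<open>w\<close> evenly between the two sums moves each off its
      centre by less than \<open>\<eta> / 2\<close>, so \<open>\<eta>\<close> itself serves as the
      radius \<delta>.\<close>
    define w where "w = p' - p"
    have w: "w \<in> V" "norm w < \<eta>"
      using p' XA by (auto simp: w_def V_def dist_norm norm_minus_commute)
    have "(2 - \<eta>) *\<^sub>R u + (1 / 2) *\<^sub>R w \<in> V" "(2 - \<eta>) *\<^sub>R u - (1 / 2) *\<^sub>R w \<in> V"
      using V(1) u(1) w(1) by (simp_all add: subspace_add subspace_diff subspace_scale)
    moreover have "norm ((2 - \<eta>) *\<^sub>R u + (1 / 2) *\<^sub>R w - (2 - \<eta>) *\<^sub>R u) \<le> \<eta> / 2"
      "norm ((2 - \<eta>) *\<^sub>R u - (1 / 2) *\<^sub>R w - (2 - \<eta>) *\<^sub>R u) \<le> \<eta> / 2"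
      using w(2) by simp_all
    ultimately have "\<exists>a\<in>V. \<exists>b\<in>V. norm a = 1 \<and> norm b = 1 \<and> norm (a - u) < e \<and> norm (b - u) < e \<and>
        a \<noteq> b \<and> a + b = (2 - \<eta>) *\<^sub>R u + (1 / 2) *\<^sub>R w"
      "\<exists>c\<in>V. \<exists>d\<in>V. norm c = 1 \<and> norm d = 1 \<and> norm (c - u) < e \<and> norm (d - u) < e \<and>
        c \<noteq> d \<and> c + d = (2 - \<eta>) *\<^sub>R u - (1 / 2) *\<^sub>R w"
      by (blast intro: \<eta>(2))+
    then obtain a b c d where
      V4: "a \<in> V" "b \<in> V" "c \<in> V" "d \<in> V" and
      n4: "norm a = 1" "norm b = 1" "norm c = 1" "norm d = 1" and
      e4: "norm (a - u) < e" "norm (b - u) < e" "norm (c - u) < e" "norm (d - u) < e" and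
      s: "a + b = (2 - \<eta>) *\<^sub>R u + (1 / 2) *\<^sub>R w" "c + d = (2 - \<eta>) *\<^sub>R u - (1 / 2) *\<^sub>R w"
      by blast
    have "a - c + b - d = w"
    proof -
      have "a - c + b - d = (a + b) - (c + d)" by simp
      also have "\<dots> = w" unfolding s by (simp flip: scaleR_2)
      finally show ?thesis .
    qed
    then have p'_eq: "p' = p + (a - c + b - d)" by (simp add: w_def)
    have "p + a \<in> X" using near_q[of a] V4 e4 e by simp
    moreover have "p + (a - c) \<in> X"
      using near_p[of "a - c"] V4 e4 e V(1) norm_triangle_ineq4[of "a - u" "c - u"]
      by (simp add: subspace_diff)
    moreover have "p + (a - c + b) \<in> X"
    proof (rule near_q)
      have "a - c + b - u = (a - c) + (b - u)" by simp
      then show "norm (a - c + b - u) < 3 * e"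
        using norm_triangle_ineq[of "a - c" "b - u"] norm_triangle_ineq4[of "a - u" "c - u"] e4
        by (simp only:) simp
    qed (use V4 V(1) in \<open>simp add: subspace_diff subspace_add\<close>)
    moreover have "dist p (p + a) = 1" "dist (p + a) (p + (a - c)) = 1"
      "dist (p + (a - c)) (p + (a - c + b)) = 1" "dist (p + (a - c + b)) p' = 1"
      using n4 by (simp_all add: dist_norm p'_eq)
    ultimately have "within_steps X (1 + 1 + 1 + 1) p p'"
      using pX p'(1) by (meson within_steps_1 within_steps_trans)
    then show "within_steps X 4 p p'" by (simp add: eval_nat_numeral)
  qed
qed

text \<open>Replace \<open>y\<close> by a nearby point \<open>z\<close> of the relative interior.
  The open segment from \<open>z\<close> to \<open>x\<close> stays in the relative interior and
  contains a point at distance 1 from \<open>x\<close>. Turning the direction slightly avoids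
  \<open>c\<close>, so that in \<open>local_walk\<close> the neighbour has in its turn a point at
  distance more than 1.\<close>

lemma rel_interior_unit_neighbour:
  fixes X :: "'a::euclidean_space set"
  assumes "convex X" and dim: "2 \<le> aff_dim X" and x: "x \<in> X" and y: "y \<in> X" "1 < dist x y"
  shows "\<exists>p\<in>rel_interior X. dist x p = 1 \<and> p \<noteq> c"
proof -
  have "y \<in> closure (rel_interior X)"
    using y(1) closure_subset convex_closure_rel_interior[OF \<open>convex X\<close>] by blast
  then obtain z where z: "z \<in> rel_interior X" "dist z y < dist x y - 1"
    using y(2) by (meson closure_approachable diff_gt_0_iff_gt)
  have xz: "1 < dist x z" using z(2) dist_triangle[of x y z] by linarith
  define u where "u = (1 / dist x z) *\<^sub>R (z - x)"
  define A where "A = affine hull X"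
  define V where "V = (\<lambda>v. v - x) ` A"
  have V: "subspace V" "2 \<le> dim V"
    unfolding V_def A_def using affine_hull_directions[OF dim, of x] x by (auto simp: hull_inc)
  have inA: "x + v \<in> A \<longleftrightarrow> v \<in> V" for v unfolding V_def by force
  have "z \<in> A" using z(1) rel_interior_subset[of X] hull_subset[of X affine] unfolding A_def by blast
  then have "z - x \<in> V" by (simp add: V_def)
  then have u: "u \<in> V" "norm u = 1"
    using V(1) xz by (auto simp: u_def subspace_scale dist_norm norm_minus_commute)
  have "x + u \<in> open_segment z x"
    unfolding in_segment using xz
    by (intro conjI exI[of _ "1 - 1 / dist x z"]) (auto simp: u_def algebra_simps divide_less_eq)
  then have "x + u \<in> rel_interior X"
    using rel_interior_closure_convex_segment[OF \<open>convex X\<close> z(1)] x closure_subset by blast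
  then obtain e where e: "0 < e" "ball (x + u) e \<inter> A \<subseteq> rel_interior X"
    unfolding A_def using rel_interior_ball by meson
  obtain \<eta> where \<eta>: "0 < \<eta>" "\<And>m. m \<in> V \<Longrightarrow> norm (m - (2 - \<eta>) *\<^sub>R u) \<le> \<eta> / 2 \<Longrightarrow>
    \<exists>a\<in>V. \<exists>b\<in>V. norm a = 1 \<and> norm b = 1 \<and> norm (a - u) < e \<and> norm (b - u) < e \<and> a \<noteq> b \<and> a + b = m"
    using sum_of_two_unit_vectors[OF V u e(1)] by blast
  \<comment> \<open>Decomposing the centre of the ball yields two different unit vectors near
    \<open>u\<close>; at most one of them leads from \<open>x\<close> to \<open>c\<close>.\<close>
  obtain a b where ab: "a \<in> V" "b \<in> V" "norm a = 1" "norm b = 1" "norm (a - u) < e" "norm (b - u) < e"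
    "a \<noteq> b"
    using \<eta>(2)[of "(2 - \<eta>) *\<^sub>R u"] \<eta>(1) u(1) V(1) by (auto simp: subspace_scale)
  have "x + v \<in> rel_interior X \<and> dist x (x + v) = 1" if "v \<in> V" "norm v = 1" "norm (v - u) < e" for v
    using that e(2) inA by (auto simp: dist_norm norm_minus_commute)
  with ab show ?thesis by (metis add_left_cancel)
qed

text \<open>The point \<open>x\<close> may lie on the relative boundary, so the four-step walk is
  made at a neighbour \<open>p\<close> in the relative interior: step to \<open>p\<close>, walk to
  the translate \<open>p + (x' - x)\<close>, step to \<open>x'\<close>. The translate lies in
  \<open>X\<close> since it is close to \<open>p\<close> and in the affine hull.\<close>

lemma local_walk:
  fixes X :: "'a::euclidean_space set"
  assumes "convex X" and dim: "2 \<le> aff_dim X"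
    and far: "\<And>z. z \<in> X \<Longrightarrow> z \<noteq> c \<Longrightarrow> \<exists>y\<in>X. 1 < dist z y" and x: "x \<in> X" "x \<noteq> c"
  obtains \<delta> where "0 < \<delta>" "\<And>x'. x' \<in> X \<Longrightarrow> dist x x' < \<delta> \<Longrightarrow> within_steps X 6 x x'"
proof -
  obtain p where p: "p \<in> rel_interior X" "dist x p = 1" "p \<noteq> c"
    using far[OF x] rel_interior_unit_neighbour[OF \<open>convex X\<close> dim x(1)] by metis
  then have pX: "p \<in> X" using rel_interior_subset by blast
  obtain q where q: "q \<in> rel_interior X" "dist p q = 1"
    using far[OF pX p(3)] rel_interior_unit_neighbour[OF \<open>convex X\<close> dim pX] by metis
  obtain \<delta> where \<delta>: "0 < \<delta>" "\<And>p'. p' \<in> X \<Longrightarrow> dist p p' < \<delta> \<Longrightarrow> within_steps X 4 p p'"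
    using rel_interior_local_walk[OF dim p(1) q] by blast
  obtain e where e: "0 < e" "ball p e \<inter> affine hull X \<subseteq> rel_interior X"
    using rel_interior_ball[OF p(1)] by blast
  show thesis
  proof (rule that[of "min \<delta> e"])
    fix x' assume x': "x' \<in> X" "dist x x' < min \<delta> e"
    define p' where "p' = p + (x' - x)"
    have d: "dist p p' = dist x x'" "dist p' x' = 1"
      using p(2) by (simp_all add: p'_def dist_norm norm_minus_commute)
    have "p + 1 *\<^sub>R (x' - x) \<in> affine hull X"
      using pX x(1) x'(1) by (intro mem_affine_3_minus) (auto simp: hull_inc affine_affine_hull)
    then have "p' \<in> X" using e(2) d(1) x'(2) rel_interior_subset by (fastforce simp: p'_def)
    then have "within_steps X (1 + 4 + 1) x x'"
      using \<delta>(2) d p(2) pX x(1) x' by (intro within_steps_trans within_steps_1) auto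
    then show "within_steps X 6 x x'" by simp
  qed (use \<delta> e in auto)
qed

section \<open>Connectedness and finite diameter\<close>

text \<open>Some point of \<open>X\<close> has distance at least 1 from \<open>x\<close>: a farthest
  one if \<open>X\<close> is bounded, since the ball through it around \<open>x\<close> contains
  \<open>X\<close>. Convexity then provides a point at distance exactly 1. This covers the
  exceptional centre too.\<close>

lemma unit_neighbour:
  fixes X :: "'a::euclidean_space set"
  assumes "closed X" "convex X" and r: "\<forall>c r. X \<subseteq> cball c r \<longrightarrow> 1 \<le> r" and x: "x \<in> X"
  shows "\<exists>y\<in>X. dist x y = 1"
proof -
  have "\<exists>y\<in>X. 1 \<le> dist x y"
  proof (cases "bounded X")
    case True
    then have "compact X" using \<open>closed X\<close> by (simp add: compact_eq_bounded_closed)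
    then obtain y where y: "y \<in> X" "\<And>z. z \<in> X \<Longrightarrow> dist x z \<le> dist x y"
      using distance_attains_sup[of X x] x by blast
    then have "X \<subseteq> cball x (dist x y)" by auto
    then show ?thesis using r y(1) by blast
  next
    case False
    then have "\<not> X \<subseteq> cball x 1" using bounded_cball bounded_subset by blast
    then show ?thesis by fastforce
  qed
  then obtain y where y: "y \<in> X" "1 \<le> dist x y" by blast
  define z where "z = x + (1 / dist x y) *\<^sub>R (y - x)"
  have "z = (1 - 1 / dist x y) *\<^sub>R x + (1 / dist x y) *\<^sub>R y" by (simp add: z_def algebra_simps)
  then have "z \<in> X" using y x \<open>convex X\<close> by (auto intro!: convexD_alt simp: divide_le_eq)
  moreover have "dist x z = 1" using y(2) by (auto simp: z_def dist_norm norm_minus_commute)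
  ultimately show ?thesis by blast
qed

text \<open>
  Two different balls of radius 1 containing \<open>X\<close> would give a smaller one around the midpoint of
  their centres.
\<close>

lemma unique_unit_centre:
  fixes X :: "'a::real_inner set"
  assumes r: "\<forall>c r. X \<subseteq> cball c r \<longrightarrow> 1 \<le> r"
  shows "\<exists>c. \<forall>z. z \<noteq> c \<longrightarrow> (\<exists>y\<in>X. 1 < dist z y)"
proof -
  have "c = c'" if "X \<subseteq> cball c 1" "X \<subseteq> cball c' 1" for c c'
  proof -
    \<comment> \<open>The square of the radius of the smaller ball around the midpoint.\<close>
    define t where "t = 1 - (norm (c - c') / 2)\<^sup>2"
    have "dist ((1 / 2) *\<^sub>R (c + c')) y \<le> sqrt t" if "y \<in> X" for y
    proof (rule real_le_rsqrt)
      have "norm (y - c) \<le> 1" "norm (y - c') \<le> 1"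
        using that \<open>X \<subseteq> cball c 1\<close> \<open>X \<subseteq> cball c' 1\<close> by (auto simp: dist_norm norm_minus_commute)
      then have "(norm (y - c))\<^sup>2 \<le> 1" "(norm (y - c'))\<^sup>2 \<le> 1" by (simp_all add: power_le_one)
      \<comment> \<open>The parallelogram law, as the formula for the length of a median.\<close>
      moreover have "(norm ((1 / 2) *\<^sub>R (c + c') - y))\<^sup>2 + (norm (c - c') / 2)\<^sup>2
          = ((norm (y - c))\<^sup>2 + (norm (y - c'))\<^sup>2) / 2"
        by (simp add: power_divide power2_norm_eq_inner inner_simps inner_commute field_simps)
      ultimately show "(dist ((1 / 2) *\<^sub>R (c + c')) y)\<^sup>2 \<le> t" by (simp add: t_def dist_norm)
    qed
    then have "X \<subseteq> cball ((1 / 2) *\<^sub>R (c + c')) (sqrt t)" by auto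
    then have "1 \<le> t" using r by force
    then show ?thesis by (simp add: t_def)
  qed
  \<comment> \<open>If no unit ball contains \<open>X\<close>, any point serves as
    \<open>c\<close>.\<close>
  then have "\<exists>c. \<forall>z. X \<subseteq> cball z 1 \<longrightarrow> z = c" by metis
  then show ?thesis by (simp add: subset_iff not_le) (metis not_le)
qed

lemma connected_within_steps:
  fixes X :: "'a::euclidean_space set"
  assumes "closed X" "convex X" and dim: "2 \<le> aff_dim X"
    and r: "\<forall>c r. X \<subseteq> cball c r \<longrightarrow> 1 \<le> r" and x: "x \<in> X" and y: "y \<in> X"
  shows "\<exists>n. within_steps X n x y"
proof -
  obtain c where c: "\<And>z. z \<in> X \<Longrightarrow> z \<noteq> c \<Longrightarrow> \<exists>y\<in>X. 1 < dist z y"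
    using unique_unit_centre[OF r] by metis
  define R where "R = (\<lambda>x y. \<exists>n. within_steps X n x y)"
  have R_sym: "R a b \<Longrightarrow> R b a" for a b unfolding R_def using within_steps_sym by blast
  have R_trans: "R a b \<Longrightarrow> R b d \<Longrightarrow> R a d" for a b d
    unfolding R_def using within_steps_trans by blast
  have punctured: "R a b" if ab: "a \<in> X - {c}" "b \<in> X - {c}" for a b
  proof (rule connected_equivalence_relation[OF _ ab])
    \<comment> \<open>Removing one point leaves a convex set of dimension at least 2
      connected.\<close>
    show "Topological_Spaces.connected (X - {c})"
      using \<open>convex X\<close> dim by (intro connected_punctured_convex) auto
    fix a assume a: "a \<in> X - {c}"
    then obtain \<delta> where \<delta>: "0 < \<delta>" "\<And>x'. x' \<in> X \<Longrightarrow> dist a x' < \<delta> \<Longrightarrow> within_steps X 6 a x'"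
      using local_walk[OF \<open>convex X\<close> dim c] by (metis DiffE singletonI)
    then have "R a x" if "x \<in> (X - {c}) \<inter> ball a \<delta>" for x
      using that unfolding R_def by auto
    then show "\<exists>T. openin (top_of_set (X - {c})) T \<and> a \<in> T \<and> (\<forall>x\<in>T. R a x)"
      using \<delta>(1) a
      by (intro exI[of _ "(X - {c}) \<inter> ball a \<delta>"]) (auto intro!: openin_open_Int)
  qed (use R_sym R_trans in blast)+
  \<comment> \<open>There may be no local walk at \<open>c\<close>, but a single unit step leaves
    it.\<close>
  have "\<exists>a'\<in>X - {c}. R a a'" if a: "a \<in> X" for a
  proof (cases "a = c")
    case True
    then obtain b where "b \<in> X" "dist a b = 1"
      using unit_neighbour[OF assms(1,2) r a] by blast
    then show ?thesis using a True unfolding R_def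
      by (metis DiffI dist_self singletonD within_steps_1 zero_neq_one)
  next
    case False
    then show ?thesis using that unfolding R_def by (metis DiffI singletonD within_steps_refl)
  qed
  then obtain x' y' where "x' \<in> X - {c}" "R x x'" "y' \<in> X - {c}" "R y y'" using x y by metis
  then have "R x y" using punctured R_sym R_trans by meson
  then show ?thesis by (simp add: R_def)
qed

lemma bounded_within_steps:
  fixes X :: "'a::euclidean_space set"
  assumes "closed X" "convex X" "bounded X" and dim: "2 \<le> aff_dim X"
    and r: "\<forall>c r. X \<subseteq> cball c r \<longrightarrow> 1 \<le> r"
  shows "\<exists>n. \<forall>x\<in>X. \<forall>y\<in>X. within_steps X n x y"
proof -
  obtain c where c: "\<And>z. z \<in> X \<Longrightarrow> z \<noteq> c \<Longrightarrow> \<exists>y\<in>X. 1 < dist z y"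
    using unique_unit_centre[OF r] by metis
  \<comment> \<open>Removing an open ball keeps \<open>K\<close> compact and away from
    \<open>c\<close>. The radius 1/2 is such that a unit step from a removed point ends in
    \<open>K\<close>, by the triangle inequality.\<close>
  define K where "K = X - ball c (1 / 2)"
  have "compact K"
    unfolding K_def using assms(1,3) by (intro compact_diff) (simp_all add: compact_eq_bounded_closed)
  obtain a where a: "a \<in> X" using dim by fastforce
  have "\<exists>\<delta>>0. \<exists>n. \<forall>x'\<in>X. dist x x' < \<delta> \<longrightarrow> within_steps X n a x'" if "x \<in> K" for x
  proof -
    have x: "x \<in> X" "x \<noteq> c" using that by (auto simp: K_def)
    obtain \<delta> where \<delta>: "0 < \<delta>" "\<And>x'. x' \<in> X \<Longrightarrow> dist x x' < \<delta> \<Longrightarrow> within_steps X 6 x x'"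
      using local_walk[OF \<open>convex X\<close> dim c x] by blast
    obtain n where "within_steps X n a x"
      using connected_within_steps[OF assms(1,2) dim r a x(1)] by blast
    then show ?thesis using \<delta> within_steps_trans by blast
  qed
  then obtain \<delta> n where \<delta>: "\<And>x. x \<in> K \<Longrightarrow> 0 < \<delta> x"
    and n: "\<And>x x'. x \<in> K \<Longrightarrow> x' \<in> X \<Longrightarrow> dist x x' < \<delta> x \<Longrightarrow> within_steps X (n x) a x'"
    by metis
  have "K \<subseteq> (\<Union>x\<in>K. ball x (\<delta> x))" using \<delta> by force
  then obtain F where F: "F \<subseteq> K" "finite F" "K \<subseteq> (\<Union>x\<in>F. ball x (\<delta> x))"
    using compactE_image[OF \<open>compact K\<close>, of K "\<lambda>x. ball x (\<delta> x)"] by auto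
  \<comment> \<open>Inserting 0 keeps the maximum meaningful when \<open>F\<close> is empty.\<close>
  define N where "N = Max (insert 0 (n ` F))"
  have inK: "within_steps X N a x" if "x \<in> K" for x
  proof -
    obtain z where z: "z \<in> F" "dist z x < \<delta> z" using F(3) \<open>x \<in> K\<close> by auto
    then have "within_steps X (n z) a x" using n F(1) \<open>x \<in> K\<close> by (auto simp: K_def)
    moreover have "n z \<le> N" using z(1) F(2) by (simp add: N_def)
    ultimately show ?thesis by (rule within_steps_mono)
  qed
  have inX: "within_steps X (N + 1) a x" if x: "x \<in> X" for x
  proof (cases "x \<in> K")
    case True
    then show ?thesis using inK within_steps_mono by (metis le_add1)
  next
    case False
    obtain y where y: "y \<in> X" "dist x y = 1" using unit_neighbour[OF assms(1,2) r x] by blast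
    have "dist c x < 1 / 2" using False x by (simp add: K_def)
    then have "y \<in> K" using y dist_triangle[of x y c] by (simp add: K_def dist_commute)
    then show ?thesis using within_steps_trans[OF inK within_steps_1] x y by (simp add: dist_commute)
  qed
  have "within_steps X (N + 1 + (N + 1)) x y" if "x \<in> X" "y \<in> X" for x y
    using that inX within_steps_sym within_steps_trans by metis
  then show ?thesis by blast
qed

section \<open>The radius and affine independence\<close>

text \<open>An affine basis chosen inside \<open>X\<close> has \<open>aff_dim X + 1\<close> points.
  Infinite sets have \<open>card\<close> 0, so \<open>3 \<le> card S\<close> also makes
  \<open>S\<close> finite.\<close>

lemma exists_affine_independent_3_iff:
  fixes X :: "'a::euclidean_space set"
  shows "(\<exists>S\<subseteq>X. 3 \<le> card S \<and> \<not> affine_dependent S) \<longleftrightarrow> 2 \<le> aff_dim X"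
proof
  assume "\<exists>S\<subseteq>X. 3 \<le> card S \<and> \<not> affine_dependent S"
  then obtain S where S: "S \<subseteq> X" "3 \<le> card S" "\<not> affine_dependent S" by blast
  then have "int (card S) \<le> aff_dim X + 1" by (intro independent_card_le_aff_dim)
  then show "2 \<le> aff_dim X" using S(2) by linarith
next
  assume "2 \<le> aff_dim X"
  moreover obtain B where B: "B \<subseteq> X" "\<not> affine_dependent B" "affine hull X = affine hull B"
    using affine_basis_exists by metis
  moreover have "int (card B) = aff_dim X + 1" using B aff_dim_unique[of B X] by simp
  ultimately show "\<exists>S\<subseteq>X. 3 \<le> card S \<and> \<not> affine_dependent S" by (intro exI[of _ B]) auto
qed

text \<open>The right-hand side avoids the minimal ball and holds vacuously for unbounded sets. It
  also ranges over negative radii, which nonemptiness excludes before the comparison with the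
  minimal radius.\<close>

lemma enclosing_radius_ge_1_iff:
  fixes X :: "'a::euclidean_space set"
  assumes "X \<noteq> {}"
  shows "1 \<le> enclosing_radius X \<longleftrightarrow> (\<forall>c r. X \<subseteq> cball c r \<longrightarrow> 1 \<le> r)"
proof (cases "bounded X")
  case True
  then obtain c r where cr: "minimal_enclosing_ball X c r" using minimal_enclosing_ball_exists by blast
  have "0 \<le> r'" if "X \<subseteq> cball c' r'" for c' r'
    using that assms zero_le_dist order_trans by (metis ex_in_conv mem_cball subsetD)
  then have "r \<le> r'" if "X \<subseteq> cball c' r'" for c' r'
    using that cr unfolding minimal_enclosing_ball_def by blast
  moreover have "X \<subseteq> cball c r" using cr by (simp add: minimal_enclosing_ball_def)
  moreover have "enclosing_radius X = ereal r" using cr by (rule minimal_enclosing_ball_radius)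
  ultimately show ?thesis by (auto simp: one_ereal_def intro: order_trans)
next
  case False
  then show ?thesis using bounded_cball bounded_subset by (auto simp: enclosing_radius_def)
qed

lemma enclosing_radius_eq_0_iff:
  fixes X :: "'a::euclidean_space set"
  shows "enclosing_radius X = 0 \<longleftrightarrow> (\<exists>c. X \<subseteq> {c})"
proof
  assume 0: "enclosing_radius X = 0"
  then have "bounded X" by (auto simp: enclosing_radius_def split: if_splits)
  then obtain c r where cr: "minimal_enclosing_ball X c r" using minimal_enclosing_ball_exists by blast
  then have "r = 0" using 0 minimal_enclosing_ball_radius by fastforce
  then show "\<exists>c. X \<subseteq> {c}" using cr by (auto simp: minimal_enclosing_ball_def)
next
  assume "\<exists>c. X \<subseteq> {c}"
  then obtain c where "minimal_enclosing_ball X c 0" by (auto simp: minimal_enclosing_ball_def)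
  then show "enclosing_radius X = 0" using minimal_enclosing_ball_radius zero_ereal_def by metis
qed

section \<open>Necessity of the two conditions\<close>

text \<open>
  The projection to \<open>X\<close> of the centre of an enclosing ball is again the centre of an enclosing ball
  of the same radius, and it has a neighbour at distance 1.
\<close>

lemma enclosing_ball_radius_ge_1:
  fixes X :: "'a::euclidean_space set"
  assumes "closed X" "convex X" "X \<noteq> {}" and nb: "\<And>x. x \<in> X \<Longrightarrow> \<exists>y\<in>X. dist x y = 1"
    and sub: "X \<subseteq> cball c r"
  shows "1 \<le> r"
proof -
  define p where "p = closest_point X c"
  have "p \<in> X" unfolding p_def using assms by (intro closest_point_in_set)
  then obtain y where y: "y \<in> X" "dist p y = 1" using nb by blast
  have "(c - p) \<bullet> (y - p) \<le> 0"
    unfolding p_def using assms y(1) by (intro closest_point_dot)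
  \<comment> \<open>Expanding around \<open>p\<close>, the squared distance from \<open>c\<close> to
    \<open>y\<close> gains the square of \<open>c - p\<close> and a nonnegative cross term.\<close>
  then have "(norm (y - p))\<^sup>2 \<le> (norm (y - c))\<^sup>2"
    using inner_ge_zero[of "c - p"]
    by (simp add: power2_norm_eq_inner inner_simps inner_commute)
  then have "dist p y \<le> dist c y" by (simp add: dist_norm norm_minus_commute power2_le_iff_abs_le)
  then show ?thesis using y sub by auto
qed

text \<open>On a line, walks move by integers, so they cannot reach points at a half-integral distance.\<close>

lemma collinear_not_connected:
  fixes X :: "'a::euclidean_space set"
  assumes "convex X" "collinear X" and ab: "a \<in> X" "b \<in> X" "a \<noteq> b"
    and conn: "\<And>x y. x \<in> X \<Longrightarrow> y \<in> X \<Longrightarrow> \<exists>n. within_steps X n x y"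
  shows False
proof -
  obtain v where v: "\<And>x y. x \<in> X \<Longrightarrow> y \<in> X \<Longrightarrow> \<exists>t. x - y = t *\<^sub>R v"
    using \<open>collinear X\<close> unfolding collinear_def by blast
  have "v \<noteq> 0" using v[OF ab(1,2)] ab(3) by auto
  define u where "u = (1 / norm v) *\<^sub>R v"
  have "norm u = 1" using \<open>v \<noteq> 0\<close> by (simp add: u_def)
  have u: "\<exists>t. x - y = t *\<^sub>R u" if xy: "x \<in> X" "y \<in> X" for x y
  proof -
    obtain t where "x - y = t *\<^sub>R v" using v xy by blast
    then show ?thesis using \<open>v \<noteq> 0\<close> by (intro exI[of _ "t * norm v"]) (simp add: u_def)
  qed
  have int: "\<exists>k::int. y - x = of_int k *\<^sub>R u" if "within_steps X n x y" for x y n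
    using that unfolding within_steps_def
  proof (induction n arbitrary: y)
    case 0
    then show ?case by (intro exI[of _ 0]) simp
  next
    case (Suc n)
    then obtain z where z: "(x, z) \<in> ((unit_steps X)\<^sup>=) ^^ n" "(z, y) \<in> (unit_steps X)\<^sup>=" by auto
    obtain k :: int where k: "z - x = of_int k *\<^sub>R u" using Suc.IH z(1) by blast
    have "\<exists>l::int. y - z = of_int l *\<^sub>R u"
    proof (cases "y = z")
      case True
      then show ?thesis by (intro exI[of _ 0]) simp
    next
      case False
      then have "z \<in> X" "y \<in> X" "norm (y - z) = 1"
        using z(2) by (auto simp: unit_steps_def dist_norm norm_minus_commute)
      moreover from this obtain t where "y - z = t *\<^sub>R u" using u by blast
      ultimately have "y - z = t *\<^sub>R u" "\<bar>t\<bar> = 1" using \<open>norm u = 1\<close> by auto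
      then show ?thesis by (cases "t = 1") (auto intro: exI[of _ 1] exI[of _ "-1"])
    qed
    then obtain l :: int where l: "y - z = of_int l *\<^sub>R u" by blast
    have "y - x = (y - z) + (z - x)" by simp
    also have "\<dots> = of_int (l + k) *\<^sub>R u" by (simp add: k l scaleR_add_left)
    finally show ?case by blast
  qed
  obtain k :: int where k: "b - a = of_int k *\<^sub>R u" using int conn ab by metis
  then have "k \<noteq> 0" using ab(3) by auto
  \<comment> \<open>With this factor \<open>z\<close> lies at distance 1/2 from \<open>a\<close>; it
    is on the segment to \<open>b\<close> because a nonzero integer has absolute value at least
    1.\<close>
  define s where "s = 1 / (2 * \<bar>real_of_int k\<bar>)"
  define z where "z = a + s *\<^sub>R (b - a)"
  have "1 \<le> \<bar>real_of_int k\<bar>" using \<open>k \<noteq> 0\<close> by linarith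
  then have "0 \<le> s" "s \<le> 1" by (auto simp: s_def field_simps)
  moreover have "z = (1 - s) *\<^sub>R a + s *\<^sub>R b" by (simp add: z_def algebra_simps)
  ultimately have "z \<in> X" using ab \<open>convex X\<close> by (auto intro: convexD_alt)
  then obtain l :: int where l: "z - a = of_int l *\<^sub>R u" using int conn ab by metis
  have "z - a = (s * of_int k) *\<^sub>R u" by (simp add: z_def k)
  with l have "(of_int l - s * of_int k) *\<^sub>R u = 0"
    by (metis right_minus_eq scaleR_diff_left)
  then have "of_int l - s * real_of_int k = 0"
    using \<open>norm u = 1\<close> by (metis norm_zero scaleR_eq_0_iff zero_neq_one)
  then have "of_int l = s * real_of_int k" by simp
  then have half: "\<bar>real_of_int l\<bar> = 1 / 2" using \<open>k \<noteq> 0\<close> by (simp add: s_def abs_mult)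
  have "l = 0 \<or> 1 \<le> \<bar>real_of_int l\<bar>" by linarith
  then show False using half by auto
qed

theorem theorem4p3:
  fixes X :: "(real ^ 'd) set"
  assumes "closed X" and "convex X"
  shows "(graph_connected (unit_distance_graph X) \<longleftrightarrow>
            enclosing_radius X = 0 \<or>
            (1 \<le> enclosing_radius X \<and> (\<exists>S\<subseteq>X. 3 \<le> card S \<and> \<not> affine_dependent S)))
       \<and> (bounded X \<and> graph_connected (unit_distance_graph X) \<longrightarrow>
            graph_diameter (unit_distance_graph X) < \<infinity>)"
proof (cases "\<exists>c. X \<subseteq> {c}")
  case True
  \<comment> \<open>This case comprises the empty set and single points, for which walks of length 0
    suffice.\<close>
  then have "within_steps X 0 x y" if "x \<in> X" "y \<in> X" for x y
    using that within_steps_refl by (metis singletonD subsetD)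
  then show ?thesis
    using True finite_graph_diameter enclosing_radius_eq_0_iff graph_connected_iff_within_steps by metis
next
  case False
  then obtain a b where ab: "a \<in> X" "b \<in> X" "a \<noteq> b" by blast
  then have ne: "X \<noteq> {}" by blast
  have rhs: "2 \<le> aff_dim X \<and> (\<forall>c r. X \<subseteq> cball c r \<longrightarrow> 1 \<le> r)"
    if conn: "graph_connected (unit_distance_graph X)"
  proof (intro conjI allI impI)
    have walk: "\<exists>n. within_steps X n x y" if "x \<in> X" "y \<in> X" for x y
      using conn that graph_connected_iff_within_steps by blast
    then have "\<not> collinear X" using collinear_not_connected[OF \<open>convex X\<close> _ ab] by blast
    then show "2 \<le> aff_dim X" by (simp add: collinear_aff_dim)
    have "\<exists>y\<in>X. dist x y = 1" if x: "x \<in> X" for x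
    proof -
      obtain y where y: "y \<in> X" "x \<noteq> y" using ab by metis
      then obtain n where "within_steps X n x y" using walk x by blast
      \<comment> \<open>Idle steps disappear in the reflexive transitive closure, so a walk from
        \<open>x\<close> to a different point starts with a genuine edge.\<close>
      then have "(x, y) \<in> ((unit_steps X)\<^sup>=)\<^sup>*" unfolding within_steps_def by (rule relpow_imp_rtrancl)
      then have "(x, y) \<in> (unit_steps X)\<^sup>*" by simp
      then obtain z where "(x, z) \<in> unit_steps X" using y(2) by (metis converse_rtranclE)
      then show ?thesis by (auto simp: unit_steps_def)
    qed
    then show "1 \<le> r" if "X \<subseteq> cball c r" for c r
      using enclosing_ball_radius_ge_1[OF assms ne _ that] by blast
  qed
  have lhs: "graph_connected (unit_distance_graph X)"
    if "2 \<le> aff_dim X" "\<forall>c r. X \<subseteq> cball c r \<longrightarrow> 1 \<le> r"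
    unfolding graph_connected_iff_within_steps using connected_within_steps[OF assms] that by blast
  have "graph_diameter (unit_distance_graph X) < \<infinity>"
    if "bounded X" "graph_connected (unit_distance_graph X)"
    using bounded_within_steps[OF assms that(1)] rhs[OF that(2)] finite_graph_diameter by blast
  then show ?thesis
    using rhs lhs False enclosing_radius_eq_0_iff[of X] enclosing_radius_ge_1_iff[OF ne]
    by (auto simp: exists_affine_independent_3_iff)
qed

end
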